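(* Let $\pi\in\Pi_M$ be a Markov policy and let $x\in K\setminus O$. Then for every $n\in\mathbb N$ $$\mathsf P^\pi_x(\tau<\tau',\ \tau<n)=\mathsf E^\pi_x\Biggl[\sum_{t=1}^{(n-1)\wedge\tau\wedge\tau'}\mathbf 1_O(x_t)\Biggr],$$ and, letting $n\to\infty$, $$\mathsf P^\pi_x(\tau<\tau',\ \tau<\infty)=\mathsf E^\pi_x\Biggl[\sum_{t=1}^{\tau\wedge\tau'}\mathbf 1_O(x_t)\Biggr],$$ where the random sum is understood as the limit of its partial sums. Consequently $$\sup_{\pi\in\Pi_M}\mathsf P^\pi_x(\tau<\tau',\ \tau<\infty)=\sup_{\pi\in\Pi_M}\mathsf E^\pi_x\Biggl[\sum_{t=1}^{\tau\wedge\tau'}\mathbf 1_O(x_t)\Biggr].$$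
   Context: A Borel space is a Borel subset of a Polish space, with Borel $\sigma$-algebra $\mathfrak B(\cdot)$; "measurable" means Borel measurable. $X$ (states) and $A$ (actions) are nonempty Borel spaces; for each $x\in X$, $A(x)$ is a nonempty measurable subset of $A$ (feasible actions); the set $\mathbb K_X=\{(x,a):x\in X,\ a\in A(x)\}$ is measurable in $X\times A$ and contains the graph of a measurable function $X\to A$; $Q$ is a stochastic kernel on $X$ given $\mathbb K_X$. $O\subsetneq K$ are nonempty measurable subsets of $X$. $\mathbb N_0=\{0,1,2,\dots\}$, $\mathbb N=\{1,2,\dots\}$, $a\wedge b=\min\{a,b\}$; an empty sum is $0$. A policy $\pi=(\pi_t)_{t\in\mathbb N_0}$ is a sequence of stochastic kernels $\pi_t$ on $A$ given the histories $h_t=(x_0,a_0,\dots,x_{t-1},a_{t-1},x_t)$ with $\pi_t(A(x_t)|h_t)=1$. Under $\mathsf P^\pi_x$ (expectation $\mathsf E^\pi_x$) one has $x_0=x$, $a_t$ has conditional law $\pi_t(\cdot|h_t)$ given $h_t$, and $x_{t+1}$ has conditional law $Q(\cdot|x_t,a_t)$ given $(h_t,a_t)$. Let $\tau=\inf\{t\in\mathbb N_0: x_t\in O\}$ and $\tau'=\inf\{t\in\mathbb N_0:x_t\in X\setminus K\}$ ($\inf\emptyset=\infty$). The process is regarded as killed at $\tau\wedge\tau'$: policies prescribe $\pi_t$ only on $\{t<\tau\wedge\tau'\}$. Nothing here depends on actions taken at times $\ge\tau\wedge\tau'$; they may be taken to be given by an arbitrary fixed feasible measurable rule. $\Pi_M$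 is the class of (randomized) Markov policies: $\pi_t(\cdot|h_t)=\varphi_t(\cdot|x_t)$ with $\varphi_t$ a stochastic kernel on $A$ given $K\setminus O$ satisfying $\varphi_t(A(x)|x)=1$. *)

theory Defs
  imports "HOL-Probability.Probability"
begin

text \<open>Borel spaces are Borel subsets of types of class \<^class>\<open>polish_space\<close>. The target set is the
  set written \<open>O\<close> in the mathematical text (the letter is an infix operator in HOL), and
  \<open>safe\<close> is \<open>K\<close>.\<close>

record ('x, 'a) control_model =
  states :: "'x set"
  actions :: "'a set"
  feasible :: "'x \<Rightarrow> 'a set"
  transition :: "'x \<times> 'a \<Rightarrow> 'x measure"
  safe :: "'x set"
  target :: "'x set"

definition state_space :: "('x::polish_space, 'a::polish_space) control_model \<Rightarrow> 'x measure" where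
  "state_space M = restrict_space borel (states M)"

definition action_space :: "('x::polish_space, 'a::polish_space) control_model \<Rightarrow> 'a measure" where
  "action_space M = restrict_space borel (actions M)"

definition feasible_pairs :: "('x::polish_space, 'a::polish_space) control_model \<Rightarrow> ('x \<times> 'a) set" where
  "feasible_pairs M = (SIGMA x:states M. feasible M x)"

definition pair_space :: "('x::polish_space, 'a::polish_space) control_model \<Rightarrow> ('x \<times> 'a) measure" where
  "pair_space M = restrict_space (state_space M \<Otimes>\<^sub>M action_space M) (feasible_pairs M)"

definition feasible_rules :: "('x::polish_space, 'a::polish_space) control_model \<Rightarrow> ('x \<Rightarrow> 'a) set" where
  "feasible_rules M =
     {f. f \<in> state_space M \<rightarrow>\<^sub>M action_space M \<and> (\<forall>x\<in>states M. f x \<in> feasible M x)}"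

locale controlled_process =
  fixes M :: "('x::polish_space, 'a::polish_space) control_model"
  assumes states: "states M \<in> sets borel" "states M \<noteq> {}"
    and actions: "actions M \<in> sets borel" "actions M \<noteq> {}"
    and feasible: "\<And>x. x \<in> states M \<Longrightarrow> feasible M x \<in> sets (action_space M)"
      "\<And>x. x \<in> states M \<Longrightarrow> feasible M x \<noteq> {}"
    and feasible_pairs: "feasible_pairs M \<in> sets (state_space M \<Otimes>\<^sub>M action_space M)"
    and feasible_rule: "feasible_rules M \<noteq> {}"
    and transition: "transition M \<in> pair_space M \<rightarrow>\<^sub>M prob_algebra (state_space M)"
    and safe: "safe M \<in> sets (state_space M)"
    and target: "target M \<in> sets (state_space M)" "target M \<noteq> {}" "target M \<subset> safe M"

text \<open>A history \<open>(x\<^sub>0, a\<^sub>0, \<dots>, x\<^sub>t\<^sub>-\<^sub>1, a\<^sub>t\<^sub>-\<^sub>1, x\<^sub>t)\<close> is encoded as the pair of the family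
  \<open>(x\<^sub>s, a\<^sub>s)\<close>, \<open>s < t\<close>, and the current state.\<close>

type_synonym ('x, 'a) history = "(nat \<Rightarrow> 'x \<times> 'a) \<times> 'x"

definition history_space ::
    "('x::polish_space, 'a::polish_space) control_model \<Rightarrow> nat \<Rightarrow> ('x, 'a) history measure" where
  "history_space M t = (\<Pi>\<^sub>M s\<in>{0..<t}. pair_space M) \<Otimes>\<^sub>M state_space M"

text \<open>The histories on which the process has not been killed up to and including time \<open>t\<close>;
  policies prescribe actions only there.\<close>

definition alive ::
    "('x::polish_space, 'a::polish_space) control_model \<Rightarrow> nat \<Rightarrow> ('x, 'a) history set" where
  "alive M t = {(\<omega>, y) \<in> space (history_space M t).
     (\<forall>s<t. fst (\<omega> s) \<in> safe M - target M) \<and> y \<in> safe M - target M}"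

type_synonym ('x, 'a) policy = "nat \<Rightarrow> ('x, 'a) history \<Rightarrow> 'a measure"

definition policies ::
    "('x::polish_space, 'a::polish_space) control_model \<Rightarrow> ('x, 'a) policy set" where
  "policies M = {\<pi>. \<forall>t.
     \<pi> t \<in> restrict_space (history_space M t) (alive M t) \<rightarrow>\<^sub>M prob_algebra (action_space M) \<and>
     (\<forall>h\<in>alive M t. emeasure (\<pi> t h) (feasible M (snd h)) = 1)}"

definition markov_policies ::
    "('x::polish_space, 'a::polish_space) control_model \<Rightarrow> ('x, 'a) policy set" where
  "markov_policies M = {\<pi> \<in> policies M. \<exists>\<phi>. \<forall>t.
     \<phi> t \<in> restrict_space (state_space M) (safe M - target M) \<rightarrow>\<^sub>M prob_algebra (action_space M) \<and>
     (\<forall>y\<in>safe M - target M. emeasure (\<phi> t y) (feasible M y) = 1) \<and>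
     (\<forall>h\<in>alive M t. \<pi> t h = \<phi> t (snd h))}"

text \<open>After killing, actions are taken according to the fixed feasible rule \<open>f\<close>.\<close>

definition completed_policy ::
    "('x::polish_space, 'a::polish_space) control_model \<Rightarrow> ('x \<Rightarrow> 'a) \<Rightarrow> ('x, 'a) policy \<Rightarrow> ('x, 'a) policy"
  where "completed_policy M f \<pi> t h =
     (if h \<in> alive M t then \<pi> t h else return (action_space M) (f (snd h)))"

definition state_kernel ::
    "('x::polish_space, 'a::polish_space) control_model \<Rightarrow> 'x \<Rightarrow> nat \<Rightarrow> (nat \<Rightarrow> 'x \<times> 'a) \<Rightarrow> 'x measure"
  where "state_kernel M x t \<omega> =
     (if t = 0 then return (state_space M) x else transition M (\<omega> (t - 1)))"

text \<open>Conditional law of \<open>(x\<^sub>t, a\<^sub>t)\<close> given \<open>(x\<^sub>s, a\<^sub>s)\<close>, \<open>s < t\<close>. It gives full mass to the feasible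
  pairs, so the restriction is again a probability measure.\<close>

definition step_kernel ::
    "('x::polish_space, 'a::polish_space) control_model \<Rightarrow> ('x \<Rightarrow> 'a) \<Rightarrow> ('x, 'a) policy \<Rightarrow> 'x \<Rightarrow>
      nat \<Rightarrow> (nat \<Rightarrow> 'x \<times> 'a) \<Rightarrow> ('x \<times> 'a) measure" where
  "step_kernel M f \<pi> x t \<omega> = restrict_space
     (state_kernel M x t \<omega> \<bind>
       (\<lambda>y. distr (completed_policy M f \<pi> t (\<omega>, y)) (state_space M \<Otimes>\<^sub>M action_space M) (Pair y)))
     (feasible_pairs M)"

text \<open>The measure \<open>P\<close> on trajectories for the policy \<open>\<pi>\<close> and the initial state \<open>x\<close>: the
  Ionescu-Tulcea extension of the step kernels. See \<open>Ionescu_Tulcea_step_kernel\<close> below.\<close>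

definition law ::
    "('x::polish_space, 'a::polish_space) control_model \<Rightarrow> ('x \<Rightarrow> 'a) \<Rightarrow> ('x, 'a) policy \<Rightarrow> 'x \<Rightarrow>
      (nat \<Rightarrow> 'x \<times> 'a) measure" where
  "law M f \<pi> x = projective_family.lim UNIV
     (Ionescu_Tulcea.CI (step_kernel M f \<pi> x) (\<lambda>_. pair_space M)) (\<lambda>_. pair_space M)"

definition hit :: "'x set \<Rightarrow> (nat \<Rightarrow> 'x \<times> 'a) \<Rightarrow> enat" where
  "hit S \<omega> = Inf {enat t | t. fst (\<omega> t) \<in> S}"

definition tau :: "('x, 'a) control_model \<Rightarrow> (nat \<Rightarrow> 'x \<times> 'a) \<Rightarrow> enat" where
  "tau M = hit (target M)"

definition tau' :: "('x, 'a) control_model \<Rightarrow> (nat \<Rightarrow> 'x \<times> 'a) \<Rightarrow> enat" where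
  "tau' M = hit (states M - safe M)"

context controlled_process
begin

lemma space_state_space: "space (state_space M) = states M"
  by (simp add: state_space_def space_restrict_space)

lemma space_action_space: "space (action_space M) = actions M"
  by (simp add: action_space_def space_restrict_space)

lemma space_pair_space: "space (pair_space M) = feasible_pairs M"
  using sets.sets_into_space[OF feasible_pairs]
  by (auto simp: pair_space_def space_restrict_space)

lemma feasible_pairs_ne: "feasible_pairs M \<noteq> {}"
  using states feasible by (auto simp: feasible_pairs_def)

lemma alive_sets: "alive M t \<in> sets (history_space M t)"
proof -
  define G where "G = safe M - target M"
  have [measurable]: "G \<in> sets (state_space M)"
    using safe target by (auto simp: G_def)
  have [measurable]: "fst \<in> pair_space M \<rightarrow>\<^sub>M state_space M"
    unfolding pair_space_def by (intro measurable_restrict_space1) simp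
  have A: "alive M t = {h \<in> space (history_space M t). (\<forall>s\<in>{0..<t}. fst (fst h s) \<in> G) \<and> snd h \<in> G}"
    by (auto simp: alive_def G_def)
  show ?thesis
    unfolding A history_space_def by measurable
qed

lemma completed_policy_kernel:
  assumes pi: "\<pi> \<in> policies M" and f: "f \<in> feasible_rules M"
  shows "completed_policy M f \<pi> t \<in> history_space M t \<rightarrow>\<^sub>M prob_algebra (action_space M)"
proof -
  have "(\<lambda>h. if h \<in> alive M t then \<pi> t h else return (action_space M) (f (snd h)))
      \<in> history_space M t \<rightarrow>\<^sub>M prob_algebra (action_space M)"
  proof (subst measurable_If_restrict_space_iff)
    have [measurable]: "f \<in> state_space M \<rightarrow>\<^sub>M action_space M"
      using f by (simp add: feasible_rules_def)
    have "(\<lambda>h. return (action_space M) (f (snd h))) \<in> history_space M t \<rightarrow>\<^sub>M prob_algebra (action_space M)"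
      unfolding history_space_def by measurable
    then show "\<pi> t \<in> restrict_space (history_space M t) {h. h \<in> alive M t} \<rightarrow>\<^sub>M prob_algebra (action_space M) \<and>
      (\<lambda>h. return (action_space M) (f (snd h))) \<in> restrict_space (history_space M t) {h. h \<notin> alive M t}
        \<rightarrow>\<^sub>M prob_algebra (action_space M)"
      using pi by (auto simp: policies_def intro: measurable_restrict_space1)
  next
    show "{h \<in> space (history_space M t). h \<in> alive M t} \<in> sets (history_space M t)"
      using sets.Int[OF sets.top alive_sets, of t] by (simp add: Int_def)
  qed
  then show ?thesis by (simp add: completed_policy_def[abs_def])
qed

lemma completed_policy_feasible:
  assumes pi: "\<pi> \<in> policies M" and f: "f \<in> feasible_rules M" and h: "h \<in> space (history_space M t)"
  shows "emeasure (completed_policy M f \<pi> t h) (feasible M (snd h)) = 1"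
proof (cases "h \<in> alive M t")
  case True
  then show ?thesis using pi by (simp add: completed_policy_def policies_def)
next
  case False
  have "snd h \<in> states M"
    using h by (auto simp: history_space_def space_pair_measure space_state_space)
  then show ?thesis
    using False f feasible by (simp add: completed_policy_def feasible_rules_def)
qed

lemma state_kernel_kernel:
  assumes x: "x \<in> states M"
  shows "state_kernel M x t \<in> (\<Pi>\<^sub>M s\<in>{0..<t}. pair_space M) \<rightarrow>\<^sub>M prob_algebra (state_space M)"
proof (cases "t = 0")
  case True
  then show ?thesis
    using x by (auto simp: state_kernel_def[abs_def] space_prob_algebra prob_space_return space_state_space)
next
  case False
  then have "(\<lambda>\<omega>. \<omega> (t - 1)) \<in> (\<Pi>\<^sub>M s\<in>{0..<t}. pair_space M) \<rightarrow>\<^sub>M pair_space M"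
    by (intro measurable_component_singleton) auto
  from measurable_compose[OF this transition] False show ?thesis
    by (simp add: state_kernel_def[abs_def])
qed

lemma Ionescu_Tulcea_step_kernel:
  assumes pi: "\<pi> \<in> policies M" and f: "f \<in> feasible_rules M" and x: "x \<in> states M"
  shows "Ionescu_Tulcea (step_kernel M f \<pi> x) (\<lambda>_. pair_space M)"
proof (rule Ionescu_Tulcea.intro)
  fix t :: nat
  let ?H = "\<Pi>\<^sub>M s\<in>{0..<t}. pair_space M" and ?XA = "state_space M \<Otimes>\<^sub>M action_space M"
  let ?D = "\<lambda>\<omega> y. distr (completed_policy M f \<pi> t (\<omega>, y)) ?XA (Pair y)"
  note [measurable] = state_kernel_kernel[OF x]
  have [measurable]: "completed_policy M f \<pi> t \<in> ?H \<Otimes>\<^sub>M state_space M \<rightarrow>\<^sub>M prob_algebra (action_space M)"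
    using completed_policy_kernel[OF pi f] by (simp add: history_space_def)
  have D: "(\<lambda>(\<omega>, y). ?D \<omega> y) \<in> ?H \<Otimes>\<^sub>M state_space M \<rightarrow>\<^sub>M prob_algebra ?XA"
    unfolding split_beta' by (intro measurable_distr_prob_space2[where M="action_space M"]) measurable
  have B: "(\<lambda>\<omega>. state_kernel M x t \<omega> \<bind> ?D \<omega>) \<in> ?H \<rightarrow>\<^sub>M prob_algebra ?XA"
    by (rule measurable_bind_prob_space2[OF state_kernel_kernel[OF x] D])
  then show "step_kernel M f \<pi> x t \<in> ?H \<rightarrow>\<^sub>M subprob_algebra (pair_space M)"
    unfolding step_kernel_def[abs_def] pair_space_def
    by (intro restrict_space_measurable feasible_pairs_ne feasible_pairs measurable_prob_algebraD)
  fix \<omega> assume w: "\<omega> \<in> space ?H"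
  have K: "state_kernel M x t \<omega> \<in> space (prob_algebra (state_space M))"
    using measurable_space[OF state_kernel_kernel[OF x] w] .
  then have Ks: "sets (state_kernel M x t \<omega>) = sets (state_space M)" "prob_space (state_kernel M x t \<omega>)"
    by (auto simp: space_prob_algebra)
  have Kspace: "space (state_kernel M x t \<omega>) = states M"
    using sets_eq_imp_space_eq[OF Ks(1)] by (simp add: space_state_space)
  have Dw: "?D \<omega> \<in> state_space M \<rightarrow>\<^sub>M prob_algebra ?XA"
    using measurable_Pair2[OF D w] by simp
  have D1: "emeasure (?D \<omega> y) (feasible_pairs M) = 1" if y: "y \<in> states M" for y
  proof -
    have h: "(\<omega>, y) \<in> space (history_space M t)"
      using w y by (simp add: history_space_def space_pair_measure space_state_space)
    have C: "completed_policy M f \<pi> t (\<omega>, y) \<in> space (prob_algebra (action_space M))"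
      using measurable_space[OF completed_policy_kernel[OF pi f] h] .
    then have Cs: "sets (completed_policy M f \<pi> t (\<omega>, y)) = sets (action_space M)"
      by (simp add: space_prob_algebra)
    have "emeasure (?D \<omega> y) (feasible_pairs M) = emeasure (completed_policy M f \<pi> t (\<omega>, y))
        (Pair y -` feasible_pairs M \<inter> space (completed_policy M f \<pi> t (\<omega>, y)))"
      using y by (intro emeasure_distr feasible_pairs)
        (simp add: measurable_cong_sets[OF Cs refl] space_state_space)
    also have "Pair y -` feasible_pairs M \<inter> space (completed_policy M f \<pi> t (\<omega>, y)) = feasible M y"
      using y sets.sets_into_space[OF feasible(1)[OF y]] sets_eq_imp_space_eq[OF Cs]
      by (auto simp: feasible_pairs_def)
    finally show ?thesis
      using completed_policy_feasible[OF pi f h] by simp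
  qed
  have "emeasure (state_kernel M x t \<omega> \<bind> ?D \<omega>) (feasible_pairs M)
      = (\<integral>\<^sup>+y. emeasure (?D \<omega> y) (feasible_pairs M) \<partial>state_kernel M x t \<omega>)"
    by (rule emeasure_bind_prob_algebra[OF K Dw feasible_pairs])
  also have "\<dots> = (\<integral>\<^sup>+y. 1 \<partial>state_kernel M x t \<omega>)"
    by (intro nn_integral_cong D1) (simp add: Kspace)
  also have "\<dots> = 1"
    using prob_space.emeasure_space_1[OF Ks(2)] by simp
  finally have E: "emeasure (state_kernel M x t \<omega> \<bind> ?D \<omega>) (feasible_pairs M) = 1" .
  have S: "sets (state_kernel M x t \<omega> \<bind> ?D \<omega>) = sets ?XA"
    using measurable_space[OF B w] by (simp add: space_prob_algebra)
  have "feasible_pairs M \<inter> space (state_kernel M x t \<omega> \<bind> ?D \<omega>) = feasible_pairs M"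
    using sets.sets_into_space[OF feasible_pairs] sets_eq_imp_space_eq[OF S] by auto
  then have "emeasure (step_kernel M f \<pi> x t \<omega>) (space (step_kernel M f \<pi> x t \<omega>)) = 1"
    unfolding step_kernel_def using E feasible_pairs S
    by (simp add: space_restrict_space emeasure_restrict_space)
  then show "prob_space (step_kernel M f \<pi> x t \<omega>)"
    by (rule prob_spaceI)
qed

end

end

(* Almost surely the trajectory starts outside O. On such a trajectory, since O is contained in K,
   a time 1 <= t <= min tau tau' has x_t in O exactly if t = tau < tau'. Hence the sum of
   indicators is itself the indicator of the event, and both identities hold pathwise. *)
theory Submission
  imports Defs
begin

section \<open>Law of the initial coordinate\<close>

text \<open>The event is a cylinder over the index set \<open>{0}\<close>, so the projective limit
  gives it the mass under \<open>CI {0}\<close>, which is a single extension step from the empty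
  history.\<close>

lemma (in Ionescu_Tulcea) emeasure_lim_0:
  assumes A[measurable]: "A \<in> sets (M 0)"
  shows "emeasure PF.lim {\<omega> \<in> space (PiM UNIV M). \<omega> 0 \<in> A} = emeasure (P 0 (\<lambda>_. undefined)) A"
proof -
  let ?u = "\<lambda>_::nat. undefined :: 'a"
  let ?E = "{g \<in> space (PiM {0} M). g 0 \<in> A}"
  have E: "?E \<in> sets (PiM {0} M)"
    by measurable
  \<comment> \<open>The constantly \<open>undefined\<close> function is the only point of the
    product over the empty index set: the empty history.\<close>
  have u: "?u \<in> space (PiM {0..<0} M)"
    by (simp add: space_PiM)
  have I: "{0..<Suc 0} = {0::nat}"
    by auto
  have "{\<omega> \<in> space (PiM UNIV M). \<omega> 0 \<in> A} = PF.emb UNIV {0} ?E"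
    by (auto simp: prod_emb_def space_PiM PiE_iff)
  then have "emeasure PF.lim {\<omega> \<in> space (PiM UNIV M). \<omega> 0 \<in> A} = emeasure (CI {0}) ?E"
    using lim[OF _ E] by simp
  also have "\<dots> = emeasure (C 0 (Suc 0) ?u) (PF.emb {0..<Suc 0} {0} ?E)"
    by (rule emeasure_CI[OF _ E]) simp
  also have "PF.emb {0..<Suc 0} {0} ?E = ?E"
    unfolding I by (rule prod_emb_id) (auto simp: space_PiM)
  also have "C 0 (Suc 0) ?u = eP 0 ?u"
    \<comment> \<open>\<open>C\<close> begins with \<open>return\<close> at the given history and
      binds one \<open>eP\<close> per step, so a monad law leaves \<open>eP 0\<close>.\<close>
    using bind_return[OF measurable_eP u] by simp
  also have "emeasure (eP 0 ?u) ?E = emeasure (P 0 ?u) (fun_upd ?u 0 -` ?E \<inter> space (M 0))"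
    using E by (intro emeasure_eP[OF u]) (simp add: I)
  also have "fun_upd ?u 0 -` ?E \<inter> space (M 0) = A"
    using sets.sets_into_space[OF A] by (auto simp: space_PiM PiE_iff extensional_def)
  finally show ?thesis .
qed

context controlled_process
begin

lemma measurable_fst_pair_space: "fst \<in> pair_space M \<rightarrow>\<^sub>M state_space M"
  unfolding pair_space_def by (intro measurable_restrict_space1) simp

lemma sets_law: "sets (law M f \<pi> x) = sets (\<Pi>\<^sub>M _\<in>UNIV. pair_space M)"
  if "\<pi> \<in> policies M" "f \<in> feasible_rules M" "x \<in> states M"
proof -
  interpret Ionescu_Tulcea "step_kernel M f \<pi> x" "\<lambda>_. pair_space M"
    using that by (rule Ionescu_Tulcea_step_kernel)
  show ?thesis
    unfolding law_def by (rule PF.sets_lim)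
qed

text \<open>At time 0 the state kernel is the point mass at \<open>x\<close>, so the first pair has
  state \<open>x\<close>, which lies outside \<open>B\<close>, whatever action is drawn.\<close>

lemma emeasure_step_kernel_0:
  assumes pi: "\<pi> \<in> policies M" and f: "f \<in> feasible_rules M" and x: "x \<in> states M"
    and B: "B \<in> sets (state_space M)" "x \<notin> B"
  shows "emeasure (step_kernel M f \<pi> x 0 (\<lambda>_. undefined)) {p \<in> feasible_pairs M. fst p \<in> B} = 0"
proof -
  let ?u = "\<lambda>_::nat. undefined :: 'x \<times> 'a"
  let ?XA = "state_space M \<Otimes>\<^sub>M action_space M"
  let ?c = "\<lambda>y. completed_policy M f \<pi> 0 (?u, y)"
  let ?D = "\<lambda>y. distr (?c y) ?XA (Pair y)"
  have "(\<lambda>y. (?u, y)) \<in> state_space M \<rightarrow>\<^sub>M history_space M 0"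
    unfolding history_space_def by (intro measurable_Pair1') (simp add: space_PiM)
  from measurable_compose[OF this completed_policy_kernel[OF pi f]]
  have c[measurable]: "?c \<in> state_space M \<rightarrow>\<^sub>M prob_algebra (action_space M)" .
  have D: "?D \<in> state_space M \<rightarrow>\<^sub>M prob_algebra ?XA"
    by (intro measurable_distr_prob_space2[where M="action_space M"]) measurable
  have xs: "x \<in> space (state_space M)"
    using x by (simp add: space_state_space)
  have bind: "state_kernel M x 0 ?u \<bind> ?D = ?D x"
    unfolding state_kernel_def simp_thms if_True
    by (rule bind_return[OF measurable_prob_algebraD[OF D] xs])
  have sets_c: "sets (?c x) = sets (action_space M)"
    using measurable_space[OF c xs] by (simp add: space_prob_algebra)
  \<comment> \<open>\<open>emeasure_distr\<close> evaluates the kernel before its restriction to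
    feasible pairs, hence measurability in the full product.\<close>
  have N: "{p \<in> feasible_pairs M. fst p \<in> B} \<in> sets ?XA"
  proof -
    have "{p \<in> feasible_pairs M. fst p \<in> B} = feasible_pairs M \<inter> (B \<times> space (action_space M))"
      using sets.sets_into_space[OF feasible_pairs] by (auto simp: space_pair_measure)
    then show ?thesis
      using feasible_pairs B(1) by auto
  qed
  have F: "feasible_pairs M \<inter> space ?XA = feasible_pairs M"
    using sets.sets_into_space[OF feasible_pairs] by auto
  have "emeasure (step_kernel M f \<pi> x 0 ?u) {p \<in> feasible_pairs M. fst p \<in> B}
      = emeasure (?D x) {p \<in> feasible_pairs M. fst p \<in> B}"
    unfolding step_kernel_def bind
    by (intro emeasure_restrict_space) (auto simp: F feasible_pairs)
  also have "\<dots> = emeasure (?c x) (Pair x -` {p \<in> feasible_pairs M. fst p \<in> B} \<inter> space (?c x))"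
    using xs by (intro emeasure_distr N) (simp add: measurable_cong_sets[OF sets_c refl])
  also have "Pair x -` {p \<in> feasible_pairs M. fst p \<in> B} \<inter> space (?c x) = {}"
    using B(2) by auto
  finally show ?thesis
    by simp
qed

text \<open>The null set of the first step kernel becomes a null cylinder at time 0. Taking
  \<open>target M\<close> for \<open>B\<close> supplies, almost surely, the hypothesis of the
  pathwise identities.\<close>

lemma AE_law_initial:
  assumes pi: "\<pi> \<in> policies M" and f: "f \<in> feasible_rules M" and x: "x \<in> states M"
    and B: "B \<in> sets (state_space M)" "x \<notin> B"
  shows "AE \<omega> in law M f \<pi> x. fst (\<omega> 0) \<notin> B"
proof -
  interpret Ionescu_Tulcea "step_kernel M f \<pi> x" "\<lambda>_. pair_space M"
    using pi f x by (rule Ionescu_Tulcea_step_kernel)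
  let ?N = "{p \<in> feasible_pairs M. fst p \<in> B}"
  let ?S = "{\<omega> \<in> space (\<Pi>\<^sub>M _\<in>UNIV. pair_space M). \<omega> 0 \<in> ?N}"
  have N[measurable]: "?N \<in> sets (pair_space M)"
    using measurable_sets[OF measurable_fst_pair_space B(1)]
    by (simp add: space_pair_space vimage_def Int_def conj_commute)
  have sp: "space (law M f \<pi> x) = space (\<Pi>\<^sub>M _\<in>UNIV. pair_space M)"
    by (intro sets_eq_imp_space_eq sets_law pi f x)
  have "?S \<in> sets (\<Pi>\<^sub>M _\<in>UNIV. pair_space M)"
    by measurable
  then have "?S \<in> null_sets (law M f \<pi> x)"
    unfolding null_sets_def using emeasure_lim_0[OF N] emeasure_step_kernel_0[OF assms]
    by (simp add: law_def)
  moreover have "{\<omega> \<in> space (law M f \<pi> x). \<not> fst (\<omega> 0) \<notin> B} \<subseteq> ?S"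
    by (auto simp: sp space_PiM PiE_iff space_pair_space)
  ultimately show ?thesis
    by (rule AE_I')
qed

end

section \<open>Hitting times in terms of coordinates\<close>

text \<open>Time is discrete, so an infimum at most \<open>t\<close> is attained. The other
  descriptions of \<open>hit\<close> by finitely many coordinates follow from this one.\<close>

lemma hit_le_iff: "hit S \<omega> \<le> enat t \<longleftrightarrow> (\<exists>s\<le>t. fst (\<omega> s) \<in> S)"
proof
  show "\<exists>s\<le>t. fst (\<omega> s) \<in> S" if "hit S \<omega> \<le> enat t"
  proof (rule ccontr)
    assume "\<not> (\<exists>s\<le>t. fst (\<omega> s) \<in> S)"
    \<comment> \<open>The strict bound on each hitting time is raised to the weak bound
      \<open>Suc t\<close>, because only weak bounds pass to the infimum.\<close>
    then have "enat (Suc t) \<le> hit S \<omega>"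
      unfolding hit_def by (intro Inf_greatest) (auto simp: not_le Suc_le_eq)
    with that show False
      by (meson enat_ord_simps(1) order_trans not_less_eq_eq order_refl)
  qed
next
  assume "\<exists>s\<le>t. fst (\<omega> s) \<in> S"
  then obtain s where "s \<le> t" "fst (\<omega> s) \<in> S" by blast
  then have "hit S \<omega> \<le> enat s"
    unfolding hit_def by (intro Inf_lower) auto
  with \<open>s \<le> t\<close> show "hit S \<omega> \<le> enat t"
    by (meson enat_ord_simps(1) order_trans)
qed

lemma less_hit_iff: "enat t < hit S \<omega> \<longleftrightarrow> (\<forall>s\<le>t. fst (\<omega> s) \<notin> S)"
  using hit_le_iff[of S \<omega> t] by (auto simp flip: not_le)

lemma le_hit_iff: "enat t \<le> hit S \<omega> \<longleftrightarrow> (\<forall>s<t. fst (\<omega> s) \<notin> S)"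
proof (cases t)
  \<comment> \<open>A weak bound at \<open>Suc s\<close> is a strict bound at \<open>s\<close>; for
    \<open>t = 0\<close> both sides hold trivially.\<close>
  case (Suc s)
  have "enat t \<le> hit S \<omega> \<longleftrightarrow> enat s < hit S \<omega>"
    using Suc Suc_ile_eq by simp
  then show ?thesis
    by (simp add: less_hit_iff Suc less_Suc_eq_le)
qed (simp add: zero_enat_def[symmetric])

lemma hit_eq_enat_iff: "hit S \<omega> = enat t \<longleftrightarrow> fst (\<omega> t) \<in> S \<and> (\<forall>s<t. fst (\<omega> s) \<notin> S)"
  by (metis antisym hit_le_iff le_hit_iff le_neq_implies_less order_refl)

section \<open>Pathwise evaluation of the sums\<close>

context controlled_process
begin

text \<open>A visit to the target no later than \<open>tau\<close> is the first one. Since the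
  target lies in the safe set, there is no exit at that very time, which makes the comparison with
  \<open>tau'\<close> strict.\<close>

lemma target_time_iff:
  assumes "fst (\<omega> 0) \<notin> target M"
  shows "1 \<le> t \<and> enat t \<le> min (tau M \<omega>) (tau' M \<omega>) \<and> fst (\<omega> t) \<in> target M
    \<longleftrightarrow> tau M \<omega> = enat t \<and> tau M \<omega> < tau' M \<omega>"
proof
  assume L: "1 \<le> t \<and> enat t \<le> min (tau M \<omega>) (tau' M \<omega>) \<and> fst (\<omega> t) \<in> target M"
  then have tau: "tau M \<omega> = enat t"
    by (simp add: tau_def hit_eq_enat_iff le_hit_iff)
  have "fst (\<omega> s) \<notin> states M - safe M" if "s \<le> t" for s
    \<comment> \<open>Before \<open>t\<close> the bound by \<open>tau'\<close> rules out an exit; at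
      \<open>t\<close> the state is in the target, hence safe.\<close>
    using L target that by (cases "s = t") (auto simp: tau'_def le_hit_iff)
  then have "enat t < tau' M \<omega>"
    by (simp add: tau'_def less_hit_iff)
  with tau show "tau M \<omega> = enat t \<and> tau M \<omega> < tau' M \<omega>"
    by simp
next
  assume R: "tau M \<omega> = enat t \<and> tau M \<omega> < tau' M \<omega>"
  then have "fst (\<omega> t) \<in> target M"
    by (simp add: tau_def hit_eq_enat_iff)
  \<comment> \<open>The sums start at time 1, so a visit at time 0 would be missed; the assumption
    on \<open>\<omega> 0\<close> excludes it.\<close>
  moreover from this have "1 \<le> t"
    using assms by (cases t) auto
  ultimately show "1 \<le> t \<and> enat t \<le> min (tau M \<omega>) (tau' M \<omega>) \<and> fst (\<omega> t) \<in> target M"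
    using R by auto
qed

text \<open>By \<open>target_time_iff\<close> the sum counts a set whose only possible element is
  the value of \<open>tau\<close>.\<close>

lemma target_sum_eq:
  assumes "fst (\<omega> 0) \<notin> target M"
  shows "(\<Sum>t | 1 \<le> t \<and> enat t \<le> min (enat m) (min (tau M \<omega>) (tau' M \<omega>)).
      indicator (target M) (fst (\<omega> t)))
    = (if tau M \<omega> < tau' M \<omega> \<and> tau M \<omega> \<le> enat m then 1 else 0 :: ennreal)"
proof -
  let ?T = "{t. 1 \<le> t \<and> enat t \<le> min (enat m) (min (tau M \<omega>) (tau' M \<omega>))}"
  let ?A = "{t. tau M \<omega> = enat t \<and> tau M \<omega> < tau' M \<omega> \<and> tau M \<omega> \<le> enat m}"
  have T: "finite ?T"
    by (rule finite_subset[of _ "{..m}"]) auto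
  have A: "?T \<inter> {t. fst (\<omega> t) \<in> target M} = ?A"
  proof (intro set_eqI)
    show "t \<in> ?T \<inter> {t. fst (\<omega> t) \<in> target M} \<longleftrightarrow> t \<in> ?A" for t
      using target_time_iff[of \<omega> t, OF assms] by auto
  qed
  have "(\<Sum>t\<in>?T. indicator (target M) (fst (\<omega> t))) = (of_nat (card ?A) :: ennreal)"
    unfolding indicator_def of_bool_def sum.If_cases[OF T] A by simp
  moreover have "card ?A = (if tau M \<omega> < tau' M \<omega> \<and> tau M \<omega> \<le> enat m then 1 else 0)"
  proof (cases "\<exists>k. tau M \<omega> = enat k \<and> enat k < tau' M \<omega> \<and> k \<le> m")
    case True
    then obtain k where k: "tau M \<omega> = enat k" "enat k < tau' M \<omega>" "k \<le> m"
      by blast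
    then have "?A = {k}"
      by auto
    with k show ?thesis
      by simp
  next
    case False
    then have "?A = {}"
      by auto
    with False show ?thesis
      by (cases "tau M \<omega>") auto
  qed
  ultimately show ?thesis
    by simp
qed

text \<open>Again only the term at \<open>tau\<close> can be nonzero. Finiteness of
  \<open>tau\<close> is implicit on the right, since \<open>tau M \<omega> < tau' M \<omega>\<close>
  forces it.\<close>

lemma target_series_eq:
  assumes "fst (\<omega> 0) \<notin> target M"
  shows "(\<Sum>t. if 1 \<le> t \<and> enat t \<le> min (tau M \<omega>) (tau' M \<omega>)
      then indicator (target M) (fst (\<omega> t)) else 0)
    = (if tau M \<omega> < tau' M \<omega> then 1 else 0 :: ennreal)"
proof -
  have *: "(if 1 \<le> t \<and> enat t \<le> min (tau M \<omega>) (tau' M \<omega>)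
      then indicator (target M) (fst (\<omega> t)) else 0)
    = (if tau M \<omega> = enat t \<and> tau M \<omega> < tau' M \<omega> then 1 else 0 :: ennreal)" for t
    unfolding indicator_def of_bool_def
    by (auto simp only: target_time_iff[of \<omega>, OF assms, symmetric] split: if_splits)
  show ?thesis
    unfolding *
  proof (cases "tau M \<omega>")
    case (enat k)
    then show "(\<Sum>t. if tau M \<omega> = enat t \<and> tau M \<omega> < tau' M \<omega> then 1 else 0)
        = (if tau M \<omega> < tau' M \<omega> then 1 else 0 :: ennreal)"
      using suminf_finite[of "{k}" "\<lambda>t. if k = t \<and> enat k < tau' M \<omega> then 1 else 0 :: ennreal"]
      by auto
  qed simp
qed

section \<open>Measurability and integration\<close>

text \<open>Splitting by the value of \<open>tau\<close> gives a countable union of events that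
  depend on finitely many coordinates. Letting \<open>N\<close> be an \<open>enat\<close> covers the
  finite horizon and the limit together.\<close>

lemma sets_tau_less_tau':
  "{\<omega> \<in> space (\<Pi>\<^sub>M _\<in>UNIV. pair_space M). tau M \<omega> < tau' M \<omega> \<and> tau M \<omega> < N}
    \<in> sets (\<Pi>\<^sub>M _\<in>UNIV. pair_space M)"
proof -
  have [measurable]: "safe M \<in> sets (state_space M)" "target M \<in> sets (state_space M)"
    "states M \<in> sets (state_space M)"
    using safe target sets.top[of "state_space M"] by (simp_all add: space_state_space)
  note [measurable] = measurable_fst_pair_space
  have "tau M \<omega> < tau' M \<omega> \<and> tau M \<omega> < N \<longleftrightarrow>
      (\<exists>t. tau M \<omega> = enat t \<and> enat t < tau' M \<omega> \<and> enat t < N)" for \<omega>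
    by (cases "tau M \<omega>") auto
  then have "tau M \<omega> < tau' M \<omega> \<and> tau M \<omega> < N \<longleftrightarrow>
      (\<exists>t. (fst (\<omega> t) \<in> target M \<and> (\<forall>s<t. fst (\<omega> s) \<notin> target M)) \<and>
        (\<forall>s\<le>t. fst (\<omega> s) \<notin> states M - safe M) \<and> enat t < N)" for \<omega>
    by (simp only: tau_def tau'_def hit_eq_enat_iff less_hit_iff)
  then show ?thesis
    by (simp only:) measurable
qed

text \<open>Almost every trajectory starts outside the target, so both identities are integrals of
  the pathwise ones.\<close>

lemma
  assumes pi: "\<pi> \<in> policies M" and f: "f \<in> feasible_rules M" and x: "x \<in> states M - target M"
  shows emeasure_hit_before_exit_less:
      "1 \<le> n \<Longrightarrow>
        emeasure (law M f \<pi> x) {\<omega> \<in> space (law M f \<pi> x). tau M \<omega> < tau' M \<omega> \<and> tau M \<omega> < enat n}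
        = (\<integral>\<^sup>+\<omega>. (\<Sum>t | 1 \<le> t \<and> enat t \<le> min (enat (n - 1)) (min (tau M \<omega>) (tau' M \<omega>)).
            indicator (target M) (fst (\<omega> t))) \<partial>law M f \<pi> x)"
    and emeasure_hit_before_exit:
      "emeasure (law M f \<pi> x) {\<omega> \<in> space (law M f \<pi> x). tau M \<omega> < tau' M \<omega> \<and> tau M \<omega> < \<infinity>}
        = (\<integral>\<^sup>+\<omega>. (\<Sum>t. if 1 \<le> t \<and> enat t \<le> min (tau M \<omega>) (tau' M \<omega>)
            then indicator (target M) (fst (\<omega> t)) else 0) \<partial>law M f \<pi> x)"
proof -
  let ?L = "law M f \<pi> x"
  have xs: "x \<in> states M"
    using x by simp
  have L: "sets ?L = sets (\<Pi>\<^sub>M _\<in>UNIV. pair_space M)"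
    by (rule sets_law[OF pi f xs])
  have start: "AE \<omega> in ?L. fst (\<omega> 0) \<notin> target M"
    using AE_law_initial[OF pi f xs target(1)] x by simp
  \<comment> \<open>Serves both claims: \<open>N = enat n\<close> with \<open>g\<close> the finite
    sum, and \<open>N = \<infinity>\<close> with \<open>g\<close> the series.\<close>
  have E: "emeasure ?L {\<omega> \<in> space ?L. tau M \<omega> < tau' M \<omega> \<and> tau M \<omega> < N} = (\<integral>\<^sup>+\<omega>. g \<omega> \<partial>?L)"
    if "\<And>\<omega>. fst (\<omega> 0) \<notin> target M \<Longrightarrow> g \<omega> = (if tau M \<omega> < tau' M \<omega> \<and> tau M \<omega> < N then 1 else 0)" for g N
  proof -
    let ?S = "{\<omega> \<in> space ?L. tau M \<omega> < tau' M \<omega> \<and> tau M \<omega> < N}"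
    have "?S \<in> sets ?L"
      using sets_tau_less_tau'[of N] by (simp add: L sets_eq_imp_space_eq[OF L])
    then have "emeasure ?L ?S = (\<integral>\<^sup>+\<omega>. indicator ?S \<omega> \<partial>?L)"
      by simp
    also have "\<dots> = (\<integral>\<^sup>+\<omega>. g \<omega> \<partial>?L)"
      \<comment> \<open>\<open>AE_space\<close> enters because the indicator of \<open>?S\<close>
        also tests membership in the space.\<close>
      using start AE_space by (intro nn_integral_cong_AE, eventually_elim) (simp add: that)
    finally show ?thesis .
  qed
  show "emeasure ?L {\<omega> \<in> space ?L. tau M \<omega> < tau' M \<omega> \<and> tau M \<omega> < enat n}
      = (\<integral>\<^sup>+\<omega>. (\<Sum>t | 1 \<le> t \<and> enat t \<le> min (enat (n - 1)) (min (tau M \<omega>) (tau' M \<omega>)).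
          indicator (target M) (fst (\<omega> t))) \<partial>?L)" if "1 \<le> n"
  proof (rule E)
    \<comment> \<open>Truncated subtraction makes this false for \<open>n = 0\<close> and
      \<open>i = 0\<close>; here \<open>1 \<le> n\<close> is used.\<close>
    have "i < enat n \<longleftrightarrow> i \<le> enat (n - 1)" for i
      using that by (cases i) auto
    then show "(\<Sum>t | 1 \<le> t \<and> enat t \<le> min (enat (n - 1)) (min (tau M \<omega>) (tau' M \<omega>)).
        indicator (target M) (fst (\<omega> t)))
      = (if tau M \<omega> < tau' M \<omega> \<and> tau M \<omega> < enat n then 1 else 0 :: ennreal)"
      if "fst (\<omega> 0) \<notin> target M" for \<omega>
      using target_sum_eq[of \<omega> "n - 1"] that by simp
  qed
  show "emeasure ?L {\<omega> \<in> space ?L. tau M \<omega> < tau' M \<omega> \<and> tau M \<omega> < \<infinity>}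
      = (\<integral>\<^sup>+\<omega>. (\<Sum>t. if 1 \<le> t \<and> enat t \<le> min (tau M \<omega>) (tau' M \<omega>)
          then indicator (target M) (fst (\<omega> t)) else 0) \<partial>?L)"
  proof (rule E)
    show "(\<Sum>t. if 1 \<le> t \<and> enat t \<le> min (tau M \<omega>) (tau' M \<omega>)
        then indicator (target M) (fst (\<omega> t)) else 0)
      = (if tau M \<omega> < tau' M \<omega> \<and> tau M \<omega> < \<infinity> then 1 else 0 :: ennreal)"
      if "fst (\<omega> 0) \<notin> target M" for \<omega>
      using target_series_eq[of \<omega>] that by (cases "tau M \<omega>") auto
  qed
qed

end

theorem mainTheorem5:
  fixes M :: "('x::polish_space, 'a::polish_space) control_model"
    and f :: "'x \<Rightarrow> 'a" and x :: 'x
  assumes "controlled_process M"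
    and "f \<in> feasible_rules M"
    and "x \<in> safe M - target M"
  shows "(\<forall>\<pi>\<in>markov_policies M. \<forall>n\<ge>1.
      emeasure (law M f \<pi> x) {\<omega> \<in> space (law M f \<pi> x). tau M \<omega> < tau' M \<omega> \<and> tau M \<omega> < enat n}
      = (\<integral>\<^sup>+\<omega>. (\<Sum>t | 1 \<le> t \<and> enat t \<le> min (enat (n - 1)) (min (tau M \<omega>) (tau' M \<omega>)).
            indicator (target M) (fst (\<omega> t))) \<partial>law M f \<pi> x))
    \<and> (\<forall>\<pi>\<in>markov_policies M.
      emeasure (law M f \<pi> x) {\<omega> \<in> space (law M f \<pi> x). tau M \<omega> < tau' M \<omega> \<and> tau M \<omega> < \<infinity>}
      = (\<integral>\<^sup>+\<omega>. (\<Sum>t. if 1 \<le> t \<and> enat t \<le> min (tau M \<omega>) (tau' M \<omega>)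
            then indicator (target M) (fst (\<omega> t)) else 0) \<partial>law M f \<pi> x))
    \<and> (SUP \<pi>\<in>markov_policies M.
      emeasure (law M f \<pi> x) {\<omega> \<in> space (law M f \<pi> x). tau M \<omega> < tau' M \<omega> \<and> tau M \<omega> < \<infinity>})
      = (SUP \<pi>\<in>markov_policies M.
      (\<integral>\<^sup>+\<omega>. (\<Sum>t. if 1 \<le> t \<and> enat t \<le> min (tau M \<omega>) (tau' M \<omega>)
            then indicator (target M) (fst (\<omega> t)) else 0) \<partial>law M f \<pi> x))"
proof -
  interpret controlled_process M
    by fact
  have x: "x \<in> states M - target M"
    using assms(3) sets.sets_into_space[OF safe] by (auto simp: space_state_space)
  have pi: "\<pi> \<in> policies M" if "\<pi> \<in> markov_policies M" for \<pi>
    using that by (simp add: markov_policies_def)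
  show ?thesis
    \<comment> \<open>The suprema agree because the second identity equates them policy by
      policy.\<close>
    using emeasure_hit_before_exit_less[OF pi assms(2) x] emeasure_hit_before_exit[OF pi assms(2) x]
    by (intro conjI ballI allI impI SUP_cong refl)
qed

end
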